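(* Let $\mathcal{P}^n$ be the set of convex polytopes in $\mathbb{R}^n$. A functional $Z\colon\mathcal{P}^n\to\mathbb{R}$ is a translation and $\operatorname{SL}(n)$ invariant valuation if and only if there are a constant $c_0\in\mathbb{R}$ and a Cauchy function $\zeta\colon[0,\infty)\to\mathbb{R}$ such that $$Z(P)=c_0\,V_0(P)+\zeta\big(V_n(P)\big)$$ for every $P\in\mathcal{P}^n$.
   Context: A convex polytope in $\mathbb{R}^n$ is the convex hull of a non-empty finite set of points (not necessarily full-dimensional). A functional $Z\colon\mathcal{P}^n\to\mathbb{R}$ is a valuation if $Z(P)+Z(Q)=Z(P\cup Q)+Z(P\cap Q)$ for all $P,Q\in\mathcal{P}^n$ with $P\cup Q\in\mathcal{P}^n$ (with the convention $Z(\varnothing):=0$). It is translation invariant if $Z(P+x)=Z(P)$ for all $P\in\mathcal{P}^n$, $x\in\mathbb{R}^n$, and $\operatorname{SL}(n)$ invariant if $Z(\phi P)=Z(P)$ for all $P\in\mathcal{P}^n$ and all linear maps $\phi$ of determinant $1$. $V_n$ is $n$-dimensional volume (Lebesgue measure) and $V_0$ is the Euler characteristic, so $V_0(P)=1$ for every non-empty $P$. A function $\zeta\colon[0,\infty)\to\mathbb{R}$ is a Cauchy function if $\zeta(x+y)=\zeta(x)+\zeta(y)$ for all $x,y\in[0,\infty)$. *)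

theory Defs
  imports "HOL-Analysis.Analysis" "HOL-Homology.Homology"
begin

text \<open>The library predicate \<open>polytope\<close> also admits the empty set.\<close>

definition polytopes :: "(real ^ 'n) set set" where
  "polytopes = {P. polytope P \<and> P \<noteq> {}}"

text \<open>
  Functionals on \<open>polytopes\<close> are total functions on sets of points, only the values of which on
  \<open>polytopes\<close> are used. In particular the convention that a valuation is \<open>0\<close> at the
  empty set is part of the valuation equation and does not constrain the value \<open>Z {}\<close>.
\<close>

definition valuation :: "((real ^ 'n) set \<Rightarrow> real) \<Rightarrow> bool" where
  "valuation Z \<longleftrightarrow>
     (\<forall>P\<in>polytopes. \<forall>Q\<in>polytopes. P \<union> Q \<in> polytopes \<longrightarrow>
        Z P + Z Q = Z (P \<union> Q) + (if P \<inter> Q = {} then 0 else Z (P \<inter> Q)))"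

definition translation_invariant :: "((real ^ 'n) set \<Rightarrow> real) \<Rightarrow> bool" where
  "translation_invariant Z \<longleftrightarrow> (\<forall>P\<in>polytopes. \<forall>x. Z ((\<lambda>y. y + x) ` P) = Z P)"

definition SL_invariant :: "((real ^ 'n) set \<Rightarrow> real) \<Rightarrow> bool" where
  "SL_invariant Z \<longleftrightarrow>
     (\<forall>P\<in>polytopes. \<forall>\<phi>. linear \<phi> \<and> det (matrix \<phi>) = 1 \<longrightarrow> Z (\<phi> ` P) = Z P)"

definition cauchy_function :: "(real \<Rightarrow> real) \<Rightarrow> bool" where
  "cauchy_function \<zeta> \<longleftrightarrow> (\<forall>x\<ge>0. \<forall>y\<ge>0. \<zeta> (x + y) = \<zeta> x + \<zeta> y)"

text \<open>
  The Euler characteristic is the alternating sum of the Betti numbers. The rank of an abelian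
  group is the largest \<open>n\<close> such that the free abelian group on \<open>n\<close> generators
  embeds into it; this and the sum below are only meaningful if they are finite.
\<close>

definition abelian_rank :: "('a, 'b) monoid_scheme \<Rightarrow> nat" where
  "abelian_rank G = Sup {n. mon (free_Abelian_group {..<n}) G \<noteq> {}}"

definition betti :: "nat \<Rightarrow> 'a topology \<Rightarrow> nat" where
  "betti p X = abelian_rank (homology_group (int p) X)"

definition euler_characteristic :: "'a topology \<Rightarrow> int" where
  "euler_characteristic X = (\<Sum>p | betti p X \<noteq> 0. (- 1) ^ p * int (betti p X))"

definition V0 :: "(real ^ 'n) set \<Rightarrow> real" where
  "V0 P = of_int (euler_characteristic (top_of_set P))"

definition Vn :: "(real ^ 'n) set \<Rightarrow> real" where
  "Vn P = measure lebesgue P"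

lemma mon_cong_iso:
  assumes "G \<cong> H" "group F" "group G" "group H" "mon F G \<noteq> {}"
  shows "mon F H \<noteq> {}"
proof -
  obtain f where f: "f \<in> hom F G" "inj_on f (carrier F)"
    using assms by (auto simp: mon_def)
  obtain h where h: "h \<in> hom G H" "bij_betw h (carrier G) (carrier H)"
    using assms(1) by (auto simp: is_iso_def iso_def)
  have "h \<circ> f \<in> hom F H"
    using f h by (intro hom_compose)
  moreover have "inj_on (h \<circ> f) (carrier F)"
    using f h
    by (intro comp_inj_on) (auto simp: bij_betw_def hom_def intro: inj_on_subset)
  ultimately show ?thesis by (auto simp: mon_def)
qed

lemma abelian_rank_iso:
  assumes "G \<cong> H" "group G" "group H"
  shows "abelian_rank G = abelian_rank H"
proof -
  have "H \<cong> G" using assms group.iso_sym by blast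
  then have "mon (free_Abelian_group {..<n}) G \<noteq> {} \<longleftrightarrow> mon (free_Abelian_group {..<n}) H \<noteq> {}"
    for n :: nat
    using assms mon_cong_iso group_free_Abelian_group by metis
  then show ?thesis by (simp add: abelian_rank_def)
qed

lemma abelian_rank_trivial:
  assumes "trivial_group G"
  shows "abelian_rank G = 0"
proof -
  have "n = 0" if "f \<in> mon (free_Abelian_group {..<n}) G" for n :: nat and f
  proof (rule ccontr)
    assume "n \<noteq> 0"
    then have "frag_of 0 \<in> carrier (free_Abelian_group {..<n})"
      and "0 \<in> carrier (free_Abelian_group {..<n})"
      by auto
    moreover have "frag_of (0::nat) \<noteq> 0" by simp
    ultimately have "f (frag_of 0) \<noteq> f 0"
      using that by (auto simp: mon_def dest: inj_onD)
    moreover have "f (frag_of 0) \<in> carrier G" "f 0 \<in> carrier G"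
      using that \<open>n \<noteq> 0\<close> by (auto simp: mon_def hom_def Pi_iff)
    ultimately show False using assms by (auto simp: trivial_group_def)
  qed
  then have "{n::nat. mon (free_Abelian_group {..<n}) G \<noteq> {}} \<subseteq> {0}" by auto
  then show ?thesis
    unfolding abelian_rank_def by (metis Sup_nat_empty cSup_singleton subset_singletonD)
qed

lemma abelian_rank_integer: "abelian_rank integer_group = 1"
proof -
  have "n \<le> 1" if "f \<in> mon (free_Abelian_group {..<n}) integer_group" for n :: nat and f
  proof (rule ccontr)
    assume "\<not> n \<le> 1"
    let ?F = "free_Abelian_group {..<n}"
    have c: "frag_of 0 \<in> carrier ?F" "frag_of 1 \<in> carrier ?F"
      using \<open>\<not> n \<le> 1\<close> by auto
    have inj: "inj_on f (carrier ?F)" using that by (simp add: mon_def)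
    interpret group_hom ?F integer_group f
      using that by (auto simp: group_hom_def group_hom_axioms_def mon_def)
    have pw: "f (frag_cmul k x) = k * f x" if "x \<in> carrier ?F" for k x
      using hom_int_pow[OF that, of k] that by simp
    let ?a = "f (frag_of 0)" and ?b = "f (frag_of 1)"
    have "f (frag_cmul ?b (frag_of 0)) = f (frag_cmul ?a (frag_of 1))"
      using c by (simp add: pw)
    then have eq: "frag_cmul ?b (frag_of 0) = frag_cmul ?a (frag_of (1::nat))"
      using that c keys_cmul[of ?b "frag_of 0"] keys_cmul[of ?a "frag_of 1"]
      by (auto simp: mon_def dest!: inj_onD)
    from arg_cong[OF eq, of "\<lambda>x. Poly_Mapping.lookup x 0"]
      arg_cong[OF eq, of "\<lambda>x. Poly_Mapping.lookup x 1"]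
    have "?a = 0" "?b = 0" by (auto simp: lookup_frag_of)
    moreover have "f \<one>\<^bsub>?F\<^esub> = 0" using hom_one by simp
    ultimately have "frag_of (0::nat) = 0"
      using \<open>?a = 0\<close> c(1) inj_onD[OF inj, of "frag_of 0" 0] by simp
    then show False by (metis frag_of_nonzero)
  qed
  moreover have "mon (free_Abelian_group {..<1::nat}) integer_group \<noteq> {}"
  proof -
    have "{..<1::nat} = {0}" by auto
    then have "free_Abelian_group {..<1::nat} \<cong> integer_group"
      using isomorphic_group_integer_free_Abelian_group_singleton group.iso_sym
      by (metis group_integer_group)
    then show ?thesis
      by (auto simp: is_iso_def iso_def mon_def bij_betw_def)
  qed
  ultimately show ?thesis
    unfolding abelian_rank_def by (intro cSup_eq_maximum) blast+
qed

lemma V0_eq_1: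
  fixes P :: "(real ^ 'n) set"
  assumes "P \<in> polytopes"
  shows "V0 P = 1"
proof -
  let ?X = "top_of_set P"
  have "convex P" "P \<noteq> {}"
    using assms by (auto simp: polytopes_def polytope_imp_convex)
  then have X: "contractible_space ?X" "path_connected_space ?X" "topspace ?X \<noteq> {}"
    by (auto simp: convex_imp_contractible convex_imp_path_connected)
  have 0: "betti 0 ?X = 1"
    using isomorphic_integer_zeroth_homology_group[OF X(2,3)] abelian_rank_integer
    by (simp add: betti_def abelian_rank_iso)
  have "betti p ?X = 0" if "p > 0" for p
    using that trivial_reduced_homology_group_contractible_space[OF X(1), of "int p"]
    by (simp add: betti_def abelian_rank_trivial un_reduced_homology_group)
  then have "{p. betti p ?X \<noteq> 0} = {0}" using 0 by (auto intro: ccontr)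
  then show ?thesis by (simp add: V0_def euler_characteristic_def 0)
qed

end

theory Submission
  imports Defs
begin

text \<open>
  The volume is a valuation invariant under translations and maps of determinant \<open>1\<close>, and a Cauchy
  function preserves the valuation identity; together with \<open>V0 P = 1\<close> this gives one direction.

  For the converse, look at simplices first. Up to translations and maps of determinant \<open>1\<close>, a
  full-dimensional simplex is determined by its volume, and it can be taken to be the standard simplex
  with one edge stretched to length \<open>s\<close>. Cutting it through a point of that edge and the opposite
  vertices gives two simplices of the same kind, with edge lengths \<open>s\<close> and \<open>t\<close>, say, and the common facet
  is the degenerate simplex with \<open>s = 0\<close>. So the value \<open>f s\<close> of the valuation satisfies
  \<open>f (s + t) + f 0 = f s + f t\<close>, that is, \<open>f - f 0\<close> is a Cauchy function (\<open>Z_axis_simplex_add\<close>). A simplex of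
  lower dimension can in addition be rescaled freely, since a spare direction compensates the
  determinant. There the same equation gives \<open>f 1 = f 0\<close>, so a simplex has the value of its facet, and
  finally that of a point (\<open>Z_std_simplex_lower_dim\<close>). Hence \<open>Z\<close> has the asserted form on simplices
  (\<open>Z_simplex\<close>).

  It remains to pass to polytopes. The difference of \<open>Z\<close> and the asserted form is a valuation that
  vanishes on simplices. A triangulation expresses the indicator function of a polytope as a
  combination of indicator functions of simplices, but the partial unions of simplices are not
  convex, so that the valuation identity does not apply to them directly. What is needed is that
  valuations respect every linear relation between indicator functions of polytopes
  (\<open>cut_additive_linear_relation\<close>). This is proved by cutting all the polytopes along the hyperplanes that
  bound them, one after the other, and by assigning values to the partly open cells that arise.
\<close>

section \<open>Volume under linear maps\<close>

definition stretch :: "('n \<Rightarrow> real) \<Rightarrow> real ^ 'n \<Rightarrow> real ^ 'n" where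
  "stretch c x = (\<chi> j. c j * x $ j)"

lemma linear_stretch: "linear (stretch c)"
  by (rule linearI) (simp_all add: stretch_def vec_eq_iff algebra_simps)

lemma stretch_axis: "stretch c (axis j 1) = c j *\<^sub>R axis j 1"
  by (simp add: stretch_def vec_eq_iff axis_def)

lemma det_stretch:
  fixes c :: "'n::finite \<Rightarrow> real"
  shows "det (matrix (stretch c)) = (\<Prod>j\<in>UNIV. c j)"
  by (subst det_diagonal) (simp_all add: matrix_def stretch_axis, simp_all add: axis_def)

text \<open>
  Every linear map is a product of diagonal matrices, transpositions of coordinates, maps adding
  one coordinate to another, and maps with a zero row. Being scaled by the determinant is inherited
  by compositions, so it is enough to look at these generators. The measurability of images is part
  of the predicate because it is what makes it composable.
\<close>

definition scales_volume :: "(real ^ 'n \<Rightarrow> real ^ 'n) \<Rightarrow> bool" where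
  "scales_volume f \<longleftrightarrow> linear f \<and> (\<forall>S\<in>lmeasurable. f ` S \<in> lmeasurable \<and>
     measure lebesgue (f ` S) = \<bar>det (matrix f)\<bar> * measure lebesgue S)"

lemma scales_volume_comp:
  assumes "scales_volume f" "scales_volume g"
  shows "scales_volume (f \<circ> g)"
proof -
  have lin: "linear f" "linear g" using assms by (auto simp: scales_volume_def)
  then have "matrix (f \<circ> g) = matrix f ** matrix g" by (intro matrix_compose)
  then have det: "\<bar>det (matrix (f \<circ> g))\<bar> = \<bar>det (matrix f)\<bar> * \<bar>det (matrix g)\<bar>"
    by (simp add: det_mul abs_mult)
  show ?thesis
    unfolding scales_volume_def det image_comp[symmetric]
    using assms lin by (auto simp: scales_volume_def linear_compose mult.assoc)
qed

lemma scales_volume_singular: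
  assumes "linear f" "\<And>x. f x $ i = 0"
  shows "scales_volume f"
proof -
  have "f x \<noteq> axis i 1" for x using assms(2)[of x] by (metis axis_nth zero_neq_one)
  then have "\<not> surj f" unfolding surj_def by metis
  then have inj: "\<not> inj f" using linear_injective_imp_surjective[OF assms(1)] by blast
  then have "det (matrix f) = 0" using det_nz_iff_inj[OF assms(1)] by blast
  moreover have "negligible (f ` S)" for S
    using negligible_linear_singular_image[OF assms(1) inj] .
  ultimately show ?thesis
    using assms(1) by (simp add: scales_volume_def negligible_iff_measure)
qed

lemma scales_volume_stretch: "scales_volume (stretch c)"
proof -
  have "stretch c = (\<lambda>x. \<chi> j. c j * x $ j)" by (simp add: fun_eq_iff stretch_def)
  then show ?thesis
    using linear_stretch[of c] det_stretch[of c]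
    by (simp add: scales_volume_def measurable_stretch measure_stretch)
qed

text \<open>
  Boxes decide, and a box can be translated so that its \<open>n\<close>-th coordinates start at \<open>0\<close>, which is
  the case of \<open>measure_shear_interval\<close>. The determinant is that of an elementary row operation
  on the identity matrix.
\<close>

lemma scales_volume_add_coordinate:
  fixes m n :: "'n::finite"
  assumes "m \<noteq> n"
  shows "scales_volume (\<lambda>x::real ^ 'n. \<chi> i. if i = m then x $ m + x $ n else x $ i)"
    (is "scales_volume ?f")
proof -
  have lin: "linear ?f" by (rule linearI) (auto simp: vec_eq_iff algebra_simps)
  let ?I = "mat 1 :: real ^ 'n ^ 'n"
  have "matrix ?f = (\<chi> k. if k = m then row m ?I + 1 *s row n ?I else row k ?I)"
    by (auto simp: vec_eq_iff matrix_def row_def mat_def axis_def)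
  then have det: "det (matrix ?f) = 1" using det_row_operation[OF assms, of ?I 1] by simp
  have box: "measure lebesgue (?f ` cbox a b) = 1 * measure lebesgue (cbox a b)" for a b
  proof (cases "cbox a b = {}")
    case False
    define v :: "real ^ 'n" where "v = axis n (a $ n)"
    have "cbox a b = (+) v ` cbox (a - v) (b - v)"
      using cbox_translation[of v "a - v" "b - v"] by simp
    then have cb: "measure lebesgue (cbox a b) = measure lebesgue (cbox (a - v) (b - v))"
      and "?f ` cbox a b = (+) (?f v) ` ?f ` cbox (a - v) (b - v)"
      using linear_add[OF lin] by (simp_all add: measure_translation image_image)
    then have "measure lebesgue (?f ` cbox a b) = measure lebesgue (?f ` cbox (a - v) (b - v))"
      by (simp only: measure_translation)
    also have "\<dots> = measure lebesgue (cbox (a - v) (b - v))"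
    proof (rule measure_shear_interval[OF assms])
      show "cbox (a - v) (b - v) \<noteq> {}" using False \<open>cbox a b = _\<close> by auto
      show "0 \<le> (a - v) $ n" by (simp add: v_def)
    qed
    finally show ?thesis using cb by simp
  qed simp
  have "?f ` S \<in> lmeasurable \<and> 1 * measure lebesgue S = measure lebesgue (?f ` S)"
    if "S \<in> lmeasurable" for S
    by (rule measure_linear_sufficient[OF lin that box])
  then show ?thesis
    unfolding scales_volume_def det abs_one using lin by (metis (no_types, lifting))
qed

text \<open>
  On the two coordinates concerned, the exchange is
  \<open>(x, y) \<mapsto> (x + y, y) \<mapsto> (x + y, - y) \<mapsto> (x + y, x) \<mapsto> (x + y, - x) \<mapsto> (y, - x) \<mapsto> (y, x)\<close>,
  a product of generators treated already.
\<close>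

lemma scales_volume_swap:
  fixes m n :: "'n::finite"
  assumes "m \<noteq> n"
  shows "scales_volume (\<lambda>x::real ^ 'n. \<chi> i. x $ Transposition.transpose m n i)"
proof -
  define E where "E m n x = (\<chi> i. if i = m then x $ m + x $ n else x $ i)"
    for m n :: 'n and x :: "real ^ 'n"
  define D :: "real ^ 'n \<Rightarrow> real ^ 'n" where "D = stretch (\<lambda>i. if i = n then - 1 else 1)"
  have "scales_volume (E m n)" "scales_volume (E n m)" "scales_volume D"
    unfolding E_def D_def
    by (rule scales_volume_add_coordinate[OF assms] scales_volume_add_coordinate[OF assms[symmetric]]
        scales_volume_stretch)+
  then have "scales_volume (D \<circ> E m n \<circ> D \<circ> E n m \<circ> D \<circ> E m n)"
    by (intro scales_volume_comp)
  moreover have "D \<circ> E m n \<circ> D \<circ> E n m \<circ> D \<circ> E m n = (\<lambda>x. \<chi> i. x $ Transposition.transpose m n i)"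
    using assms by (auto simp: fun_eq_iff vec_eq_iff E_def D_def stretch_def Transposition.transpose_def)
  ultimately show ?thesis by simp
qed

theorem measure_linear_image_finite:
  fixes f :: "real ^ 'n \<Rightarrow> real ^ 'n"
  assumes "linear f" "S \<in> lmeasurable"
  shows "measure lebesgue (f ` S) = \<bar>det (matrix f)\<bar> * measure lebesgue S"
proof -
  have "scales_volume f"
  proof (rule induct_linear_elementary[OF assms(1), where P = scales_volume])
    show "scales_volume (g \<circ> h)" if "scales_volume g" "scales_volume h"
      for g h :: "real ^ 'n \<Rightarrow> real ^ 'n"
      by (rule scales_volume_comp[OF that])
    show "scales_volume g" if "linear g" "\<And>x. g x $ i = 0"
      for g :: "real ^ 'n \<Rightarrow> real ^ 'n" and i
      by (rule scales_volume_singular[OF that])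
    show "scales_volume (\<lambda>x :: real ^ 'n. \<chi> i. c i * x $ i)" for c
      using scales_volume_stretch[of c] by (simp add: stretch_def[abs_def])
  qed (rule scales_volume_swap scales_volume_add_coordinate; assumption?)+
  then show ?thesis using assms(2) by (simp add: scales_volume_def)
qed

section \<open>Linear relations between polytopes\<close>

definition le_half :: "'a::euclidean_space \<times> real \<Rightarrow> 'a set" where
  "le_half h = {x. fst h \<bullet> x \<le> snd h}"

definition ge_half :: "'a::euclidean_space \<times> real \<Rightarrow> 'a set" where
  "ge_half h = {x. fst h \<bullet> x \<ge> snd h}"

definition gt_half :: "'a::euclidean_space \<times> real \<Rightarrow> 'a set" where
  "gt_half h = {x. fst h \<bullet> x > snd h}"

definition hyperplane :: "'a::euclidean_space \<times> real \<Rightarrow> 'a set" where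
  "hyperplane h = {x. fst h \<bullet> x = snd h}"

lemmas half_defs = le_half_def ge_half_def gt_half_def hyperplane_def

lemma polytope_Int_half [simp]:
  assumes "polytope K"
  shows "polytope (K \<inter> le_half h)" "polytope (K \<inter> ge_half h)" "polytope (K \<inter> hyperplane h)"
  using assms unfolding half_defs
  by (simp_all add: polytope_Int_polyhedron polyhedron_halfspace_le polyhedron_halfspace_ge
      polyhedron_hyperplane)

text \<open>
  The valuation identity for the two parts into which a hyperplane cuts a polytope. One of the parts
  may be empty, so the empty set is admitted here, with value \<open>0\<close>.
\<close>

definition cut_additive :: "('a::euclidean_space set \<Rightarrow> real) \<Rightarrow> bool" where
  "cut_additive Y \<longleftrightarrow> Y {} = 0 \<and>
     (\<forall>K h. polytope K \<longrightarrow>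
        Y K = Y (K \<inter> le_half h) + Y (K \<inter> ge_half h) - Y (K \<inter> hyperplane h))"

lemma cut_additive_empty: "cut_additive Y \<Longrightarrow> Y {} = 0"
  by (simp add: cut_additive_def)

lemma cut_additive_cut:
  assumes "cut_additive Y" "polytope K"
  shows "Y K = Y (K \<inter> le_half h) + Y (K \<inter> ge_half h) - Y (K \<inter> hyperplane h)"
  using assms unfolding cut_additive_def by blast

text \<open>
  The value that a valuation assigns to the partly open set \<open>K \<inter> gt_half h\<^sub>1 \<inter> \<dots> \<inter> gt_half h\<^sub>k\<close>,
  if an open half-space counts as the closed one minus its bounding hyperplane. The set itself
  need not be a polytope, so the value is defined through the \<open>2^k\<close> closed pieces.
\<close>

primrec open_part :: "('a::euclidean_space set \<Rightarrow> real) \<Rightarrow> ('a \<times> real) list \<Rightarrow> 'a set \<Rightarrow> real" where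
  "open_part Y [] K = Y K"
| "open_part Y (h # hs) K = open_part Y hs (K \<inter> ge_half h) - open_part Y hs (K \<inter> hyperplane h)"

lemma open_part_cut_additive:
  assumes "cut_additive Y"
  shows "cut_additive (open_part Y hs)"
proof (induction hs)
  case Nil
  then show ?case using assms by (simp add: cut_additive_def)
next
  case (Cons g hs)
  have IH0: "open_part Y hs {} = 0"
    using cut_additive_empty[OF Cons] .
  have IH: "open_part Y hs K = open_part Y hs (K \<inter> le_half h) + open_part Y hs (K \<inter> ge_half h)
      - open_part Y hs (K \<inter> hyperplane h)" if "polytope K" for K h
    using cut_additive_cut[OF Cons that] .
  show ?case
    unfolding cut_additive_def
  proof (intro conjI allI impI)
    show "open_part Y (g # hs) {} = 0" by (simp add: IH0)
  next
    fix K :: "'a set" and h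
    assume K: "polytope K"
    show "open_part Y (g # hs) K = open_part Y (g # hs) (K \<inter> le_half h)
        + open_part Y (g # hs) (K \<inter> ge_half h) - open_part Y (g # hs) (K \<inter> hyperplane h)"
      using IH[of "K \<inter> ge_half g" h] IH[of "K \<inter> hyperplane g" h] K
      by (simp add: Int_ac)
  qed
qed

lemma open_part_on_hyperplane:
  assumes "h \<in> set hs" "K \<subseteq> hyperplane h"
  shows "open_part Y hs K = 0"
  using assms
proof (induction hs arbitrary: K)
  case (Cons g hs)
  show ?case
  proof (cases "h = g")
    case True
    then have "K \<inter> ge_half g = K" "K \<inter> hyperplane g = K"
      using Cons.prems by (auto simp: half_defs)
    then show ?thesis by simp
  next
    case False
    then have "open_part Y hs (K \<inter> ge_half g) = 0" "open_part Y hs (K \<inter> hyperplane g) = 0"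
      using Cons.prems by (auto intro!: Cons.IH)
    then show ?thesis by simp
  qed
qed simp

text \<open>
  Makes it possible to assume that \<open>K\<close> lies in all the closed half-spaces, where emptiness of the
  open cell has a simple reason (next lemma).
\<close>

lemma open_part_closed_cell: "open_part Y hs K = open_part Y hs (K \<inter> (\<Inter>h\<in>set hs. ge_half h))"
proof (induction hs arbitrary: K)
  case (Cons g hs)
  let ?C = "\<Inter>h\<in>set hs. ge_half h"
  have eq: "K \<inter> (\<Inter>h\<in>set (g # hs). ge_half h) \<inter> ge_half g = K \<inter> ge_half g \<inter> ?C"
    "K \<inter> (\<Inter>h\<in>set (g # hs). ge_half h) \<inter> hyperplane g = K \<inter> hyperplane g \<inter> ?C"
    by (auto simp: half_defs)
  show ?case
    using Cons.IH[of "K \<inter> ge_half g"] Cons.IH[of "K \<inter> hyperplane g"]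
    by (simp only: open_part.simps eq)
qed simp

text \<open>
  If \<open>K\<close> lies on the nonnegative side of every hyperplane and leaves each of them somewhere, then
  averaging such points gives a point that leaves all of them at once.
\<close>

lemma convex_meets_open_cell:
  assumes "convex K" "K \<noteq> {}" "finite H" "\<And>h. h \<in> H \<Longrightarrow> K \<subseteq> ge_half h"
    and "\<And>h. h \<in> H \<Longrightarrow> \<not> K \<subseteq> hyperplane h"
  shows "K \<inter> (\<Inter>h\<in>H. gt_half h) \<noteq> {}"
  using assms(3,4,5)
proof (induction H)
  case empty
  then show ?case using assms(2) by simp
next
  case (insert g H)
  then obtain x where x: "x \<in> K" "\<And>h. h \<in> H \<Longrightarrow> x \<in> gt_half h" by fastforce
  obtain y where y: "y \<in> K" "y \<notin> hyperplane g" using insert.prems(2) by blast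
  \<comment> \<open>The midpoint of two points in \<open>ge_half h\<close> lies in \<open>gt_half h\<close> as soon as one of them does.\<close>
  let ?m = "(1/2) *\<^sub>R x + (1/2) *\<^sub>R y"
  have "?m \<in> K" using x y assms(1) by (auto simp: convex_def)
  moreover have "?m \<in> gt_half h" if h: "h \<in> insert g H" for h
  proof -
    have "x \<in> ge_half h" "y \<in> ge_half h" using insert.prems(1)[OF h] x y by auto
    moreover have "x \<in> gt_half h \<or> y \<in> gt_half h"
      using h x(2)[of h] y(2) \<open>y \<in> ge_half h\<close> by (auto simp: half_defs)
    ultimately show ?thesis by (auto simp: half_defs inner_add_right)
  qed
  ultimately show ?case by blast
qed

text \<open>
  The point where convexity enters: the definition of \<open>open_part\<close> uses closed pieces, which may all
  be nonempty although the open cell is empty. But then, inside the closed cell, \<open>K\<close> is empty or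
  lies on one of the hyperplanes, and the alternating terms cancel in pairs.
\<close>

lemma open_part_eq_0:
  assumes "cut_additive Y" "convex K" "K \<inter> (\<Inter>h\<in>set hs. gt_half h) = {}"
  shows "open_part Y hs K = 0"
proof -
  let ?K = "K \<inter> (\<Inter>h\<in>set hs. ge_half h)"
  have "convex (ge_half h)" for h :: "'a \<times> real"
    unfolding ge_half_def by (rule convex_halfspace_ge)
  then have "convex ?K" using assms(2) by (intro convex_Int convex_INT) auto
  moreover have "?K \<inter> (\<Inter>h\<in>set hs. gt_half h) = {}" using assms(3) by auto
  ultimately have "?K = {} \<or> (\<exists>h\<in>set hs. ?K \<subseteq> hyperplane h)"
    using convex_meets_open_cell[of ?K "set hs"] by blast
  then have "open_part Y hs ?K = 0"
  proof
    assume e: "?K = {}"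
    show ?thesis using cut_additive_empty[OF open_part_cut_additive[OF assms(1)]] unfolding e .
  qed (auto intro: open_part_on_hyperplane)
  then show ?thesis using open_part_closed_cell[of Y hs K] by simp
qed

text \<open>
  Induction on the list of half-spaces out of which the \<open>K i\<close> are cut. Splitting along the first
  half-space \<open>h\<close>, the closed side is a relation without \<open>h\<close>, because \<open>L\<close> absorbs it. On the open
  other side all \<open>K i\<close> that are contained in \<open>le_half h\<close> disappear, so that this is a relation without
  \<open>h\<close> as well, with one more open constraint. In the end all \<open>K i\<close> equal \<open>L\<close>, and either \<open>L\<close> misses
  the open cell or the coefficients add up to \<open>0\<close>.
\<close>

lemma open_part_linear_relation:
  fixes \<alpha> :: "'i \<Rightarrow> real"
  assumes "cut_additive Y" "finite I"
    and "\<And>i. i \<in> I \<Longrightarrow> J i \<subseteq> set hs"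
    and "\<And>i. i \<in> I \<Longrightarrow> K i = L \<inter> (\<Inter>h\<in>J i. le_half h)"
    and "\<And>i. i \<in> I \<Longrightarrow> polytope (K i)"
    and "\<And>x. x \<in> (\<Inter>g\<in>set gs. gt_half g) \<Longrightarrow> (\<Sum>i\<in>I. \<alpha> i * indicator (K i) x) = 0"
  shows "(\<Sum>i\<in>I. \<alpha> i * open_part Y gs (K i)) = 0"
  using assms(2-)
proof (induction hs arbitrary: gs I J K L)
  case Nil
  then have K: "K i = L" if "i \<in> I" for i using that by auto
  show ?case
  proof (cases "I = {} \<or> L \<inter> (\<Inter>g\<in>set gs. gt_half g) = {}")
    case True
    then have "open_part Y gs (K i) = 0" if "i \<in> I" for i
      using that K[OF that] Nil.prems(4)[OF that]
      by (intro open_part_eq_0 assms(1) polytope_imp_convex) auto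
    then show ?thesis by simp
  next
    case False
    then obtain x where x: "x \<in> L" "x \<in> (\<Inter>g\<in>set gs. gt_half g)" by blast
    have "(\<Sum>i\<in>I. \<alpha> i) = (\<Sum>i\<in>I. \<alpha> i * indicator (K i) x)"
      using K x by (intro sum.cong) auto
    then have "(\<Sum>i\<in>I. \<alpha> i) = 0" using Nil.prems(5)[OF x(2)] by simp
    moreover have "(\<Sum>i\<in>I. \<alpha> i * open_part Y gs (K i)) = (\<Sum>i\<in>I. \<alpha> i) * open_part Y gs L"
      using K by (simp add: sum_distrib_right)
    ultimately show ?thesis by simp
  qed
next
  case (Cons h hs)
  define I' where "I' = {i \<in> I. h \<notin> J i}"
  have split: "open_part Y gs (K i) = open_part Y gs (K i \<inter> le_half h) + open_part Y (h # gs) (K i)"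
    if "i \<in> I" for i
    using cut_additive_cut[OF open_part_cut_additive[OF assms(1), of gs] Cons.prems(4)[OF that], of h]
    by simp
  have "(\<Sum>i\<in>I. \<alpha> i * open_part Y gs (K i \<inter> le_half h)) = 0"
  proof (rule Cons.IH[where J = "\<lambda>i. J i - {h}" and L = "L \<inter> le_half h"])
    show "(\<Sum>i\<in>I. \<alpha> i * indicator (K i \<inter> le_half h) x) = 0"
      if "x \<in> (\<Inter>g\<in>set gs. gt_half g)" for x
      using Cons.prems(5)[OF that]
      by (simp add: indicator_inter_arith mult.assoc[symmetric] flip: sum_distrib_right)
  qed (use Cons.prems in auto)
  moreover have "(\<Sum>i\<in>I. \<alpha> i * open_part Y (h # gs) (K i)) = 0"
  proof -
    have "open_part Y (h # gs) (K i) = 0" if "i \<in> I - I'" for i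
    proof -
      have "K i \<inter> ge_half h = K i \<inter> hyperplane h"
      proof -
        have "K i \<subseteq> le_half h" using that Cons.prems(3)[of i] by (auto simp: I'_def)
        then show ?thesis by (fastforce simp: half_defs)
      qed
      then show ?thesis by simp
    qed
    then have "(\<Sum>i\<in>I. \<alpha> i * open_part Y (h # gs) (K i))
        = (\<Sum>i\<in>I'. \<alpha> i * open_part Y (h # gs) (K i))"
      using Cons.prems(1) by (intro sum.mono_neutral_right) (auto simp: I'_def)
    also have "\<dots> = 0"
    proof (rule Cons.IH[where J = J and L = L])
      fix x assume x: "x \<in> (\<Inter>g\<in>set (h # gs). gt_half g)"
      have "x \<notin> K i" if "i \<in> I - I'" for i
      proof -
        have "K i \<subseteq> le_half h" using that Cons.prems(3)[of i] by (auto simp: I'_def)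
        then show ?thesis using x by (auto simp: half_defs)
      qed
      then have "(\<Sum>i\<in>I'. \<alpha> i * indicator (K i) x) = (\<Sum>i\<in>I. \<alpha> i * indicator (K i) x)"
        using Cons.prems(1) by (intro sum.mono_neutral_left) (auto simp: I'_def)
      also have "\<dots> = 0" using x by (intro Cons.prems(5)) auto
      finally show "(\<Sum>i\<in>I'. \<alpha> i * indicator (K i) x) = 0" .
    qed (use Cons.prems in \<open>auto simp: I'_def\<close>)
    finally show ?thesis .
  qed
  ultimately show ?case by (simp add: split distrib_left sum.distrib del: open_part.simps)
qed

text \<open>
  A valuation on polytopes is only required to be additive if a union happens to be convex. This
  theorem (the extension theorem of Volland and Groemer) says that it nevertheless respects all linear
  relations between indicator functions, in particular inclusion-exclusion for arbitrary covers.
\<close>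

theorem cut_additive_linear_relation:
  fixes \<alpha> :: "'i \<Rightarrow> real"
  assumes "cut_additive Y" "finite I" "\<And>i. i \<in> I \<Longrightarrow> polytope (K i)"
    and "\<And>x. (\<Sum>i\<in>I. \<alpha> i * indicator (K i) x) = 0"
  shows "(\<Sum>i\<in>I. \<alpha> i * Y (K i)) = 0"
proof -
  have "\<exists>J. finite J \<and> K i = (\<Inter>h\<in>J. le_half h)" if i: "i \<in> I" for i
  proof -
    obtain F where F: "finite F" "K i = \<Inter>F" "\<forall>h\<in>F. \<exists>a b. a \<noteq> 0 \<and> h = {x. a \<bullet> x \<le> b}"
      using polytope_imp_polyhedron[OF assms(3)[OF i]] unfolding polyhedron_def by blast
    have "\<forall>S\<in>F. \<exists>h. S = le_half h" using F(3) by (force simp: le_half_def)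
    then obtain f where "\<forall>S\<in>F. S = le_half (f S)" by metis
    then show ?thesis using F(1,2) by (intro exI[of _ "f ` F"]) auto
  qed
  then obtain J where J: "\<And>i. i \<in> I \<Longrightarrow> finite (J i)" "\<And>i. i \<in> I \<Longrightarrow> K i = (\<Inter>h\<in>J i. le_half h)"
    by metis
  obtain hs where hs: "set hs = (\<Union>i\<in>I. J i)"
    using finite_list[of "\<Union>i\<in>I. J i"] J(1) assms(2) by auto
  have "(\<Sum>i\<in>I. \<alpha> i * open_part Y [] (K i)) = 0"
    by (rule open_part_linear_relation[where J = J and L = UNIV and hs = hs])
      (use assms J(2) hs in auto)
  then show ?thesis by simp
qed

text \<open>
  Triangulate \<open>P\<close>. Expanding the product of \<open>1 - indicator S\<close> over the simplices \<open>S\<close> of the triangulation,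
  which vanishes on \<open>P\<close>, writes the indicator of \<open>P\<close> as a combination of indicators of intersections of
  these simplices; they are simplices of the complex again. The term of the empty family is \<open>P\<close>
  itself, which is why the index sets are all subsets and the sets are intersected with \<open>P\<close>.
\<close>

lemma cut_additive_vanishes_on_polytopes:
  fixes Y :: "'a::euclidean_space set \<Rightarrow> real"
  assumes "cut_additive Y" "\<And>n S. n simplex S \<Longrightarrow> Y S = 0" "polytope P"
  shows "Y P = 0"
proof -
  obtain T where T: "simplicial_complex T" "\<Union>T = P"
    by (rule simplicial_subdivision_of_cell_complex[of "{P}"])
      (use assms(3) in \<open>auto simp: face_of_refl polytope_imp_convex\<close>)
  then have fin: "finite T" by (simp add: simplicial_complex_def)
  have Int: "\<Inter>A \<in> T" if "finite A" "A \<noteq> {}" "A \<subseteq> T" for A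
    using that
  proof (induction A rule: finite_ne_induct)
    case (insert S A)
    then have "S \<inter> \<Inter>A face_of S" using T(1) by (simp add: simplicial_complex_def)
    then show ?case using T(1) insert.prems by (auto simp: simplicial_complex_def)
  qed auto
  have simplex: "\<exists>n. n simplex (P \<inter> \<Inter>A)" if "A \<subseteq> T" "A \<noteq> {}" for A
  proof -
    have "\<Inter>A \<in> T" using that fin by (intro Int) (auto intro: finite_subset)
    moreover from this have "P \<inter> \<Inter>A = \<Inter>A" using T(2) by blast
    ultimately show ?thesis using T(1) by (auto simp: simplicial_complex_def)
  qed
  have "(\<Sum>A\<in>Pow T. (- 1) ^ card A * Y (P \<inter> \<Inter>A)) = 0"
  proof (rule cut_additive_linear_relation[OF assms(1)])
    show "finite (Pow T)" using fin by simp
    show "polytope (P \<inter> \<Inter>A)" if "A \<in> Pow T" for A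
      using that simplex[of A] assms(3) by (cases "A = {}") (auto dest: simplex_imp_polytope)
    fix x
    have "(\<Sum>A\<in>Pow T. (- 1) ^ card A * indicator (P \<inter> \<Inter>A) x)
        = indicator P x * (\<Sum>A\<in>Pow T. (\<Prod>S\<in>A. - indicator S x) * (\<Prod>S\<in>T - A. 1 :: real))"
      unfolding sum_distrib_left
    proof (intro sum.cong refl)
      fix A assume "A \<in> Pow T"
      then have "finite A" using fin by (auto intro: finite_subset)
      then have "(\<Prod>S\<in>A. indicator S x :: real) = indicator (\<Inter>A) x"
        by (induction A rule: finite_induct) (auto simp: indicator_inter_arith)
      then show "(- 1) ^ card A * indicator (P \<inter> \<Inter>A) x
          = indicator P x * ((\<Prod>S\<in>A. - indicator S x) * (\<Prod>S\<in>T - A. 1 :: real))"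
        by (simp add: prod_uminus indicator_inter_arith)
    qed
    also have "\<dots> = indicator P x * (\<Prod>S\<in>T. - indicator S x + 1)"
      by (simp only: prod_add[OF fin])
    also have "\<dots> = 0"
    proof (cases "x \<in> P")
      case True
      then obtain S where "S \<in> T" "x \<in> S" using T(2) by blast
      then have "\<exists>S\<in>T. - indicator S x + 1 = (0 :: real)" by force
      then have "(\<Prod>S\<in>T. - indicator S x + 1 :: real) = 0" by (rule prod_zero[OF fin])
      then show ?thesis by simp
    qed simp
    finally show "(\<Sum>A\<in>Pow T. (- 1) ^ card A * indicator (P \<inter> \<Inter>A) x) = (0::real)" .
  qed
  moreover have "(\<Sum>A\<in>Pow T. (- 1) ^ card A * Y (P \<inter> \<Inter>A))
      = (\<Sum>A\<in>{{}}. (- 1) ^ card A * Y (P \<inter> \<Inter>A))"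
  proof (intro sum.mono_neutral_right ballI)
    fix A assume "A \<in> Pow T - {{}}"
    then have "Y (P \<inter> \<Inter>A) = 0" using simplex[of A] assms(2) by blast
    then show "(- 1) ^ card A * Y (P \<inter> \<Inter>A) = 0" by simp
  qed (use fin in auto)
  ultimately show ?thesis by simp
qed

lemma valuation_cut_additive:
  fixes Z :: "(real ^ 'n) set \<Rightarrow> real"
  assumes "valuation Z"
  shows "cut_additive (\<lambda>P. if P = {} then 0 else Z P)"
  unfolding cut_additive_def
proof (intro conjI allI impI)
  fix K :: "(real ^ 'n) set" and h
  assume K: "polytope K"
  let ?A = "K \<inter> le_half h" and ?B = "K \<inter> ge_half h"
  have eq: "?A \<union> ?B = K" "?A \<inter> ?B = K \<inter> hyperplane h"
    by (auto simp: half_defs)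
  consider "?A = {}" | "?B = {}" | "?A \<noteq> {}" "?B \<noteq> {}" by blast
  then show "(if K = {} then 0 else Z K) = (if ?A = {} then 0 else Z ?A)
      + (if ?B = {} then 0 else Z ?B)
      - (if K \<inter> hyperplane h = {} then 0 else Z (K \<inter> hyperplane h))"
  proof cases
    case 3
    then have "?A \<in> polytopes" "?B \<in> polytopes" "?A \<union> ?B \<in> polytopes"
      using K by (auto simp: polytopes_def eq(1))
    then have "Z ?A + Z ?B = Z K + (if K \<inter> hyperplane h = {} then 0 else Z (K \<inter> hyperplane h))"
      using assms unfolding valuation_def by (metis eq)
    then show ?thesis using 3 by auto
  qed (use eq in auto)
qed simp

corollary valuation_vanishes_on_polytopes:
  fixes Z :: "(real ^ 'n) set \<Rightarrow> real"
  assumes "valuation Z" "\<And>n S. n simplex S \<Longrightarrow> S \<noteq> {} \<Longrightarrow> Z S = 0" "P \<in> polytopes"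
  shows "Z P = 0"
  using cut_additive_vanishes_on_polytopes[OF valuation_cut_additive[OF assms(1)], of P] assms(2,3)
  by (auto simp: polytopes_def split: if_splits)

section \<open>Cauchy functions of the volume\<close>

lemma valuation_representation:
  fixes Z :: "(real ^ 'n) set \<Rightarrow> real"
  assumes "cauchy_function \<zeta>" and Z: "\<And>P. P \<in> polytopes \<Longrightarrow> Z P = c0 * V0 P + \<zeta> (Vn P)"
  shows "valuation Z" "translation_invariant Z" "SL_invariant Z"
proof -
  have Z': "Z P = c0 + \<zeta> (Vn P)" if "P \<in> polytopes" for P
    using Z[OF that] V0_eq_1[OF that] by simp
  show "valuation Z"
    unfolding valuation_def
  proof (intro ballI impI)
    fix P Q :: "(real ^ 'n) set"
    assume PQ: "P \<in> polytopes" "Q \<in> polytopes" "P \<union> Q \<in> polytopes"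
    have "closed P" "closed Q" "connected (P \<union> Q)" "P \<noteq> {}" "Q \<noteq> {}"
      using PQ by (auto simp: polytopes_def polytope_imp_closed polytope_imp_convex convex_connected)
    \<comment> \<open>Two disjoint nonempty closed sets do not have a connected union.\<close>
    then have ne: "P \<inter> Q \<noteq> {}" unfolding connected_closed by blast
    then have PiQ: "P \<inter> Q \<in> polytopes" using PQ by (auto simp: polytopes_def polytope_Int)
    have "Vn (P \<union> Q) = Vn P + Vn Q - Vn (P \<inter> Q)"
      unfolding Vn_def using PQ
      by (intro measure_Un3) (auto simp: polytopes_def polytope_imp_compact lmeasurable_compact)
    then have "\<zeta> (Vn (P \<union> Q) + Vn (P \<inter> Q)) = \<zeta> (Vn P + Vn Q)" by simp
    then have "\<zeta> (Vn (P \<union> Q)) + \<zeta> (Vn (P \<inter> Q)) = \<zeta> (Vn P) + \<zeta> (Vn Q)"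
      using assms(1) by (simp add: cauchy_function_def Vn_def)
    then show "Z P + Z Q = Z (P \<union> Q) + (if P \<inter> Q = {} then 0 else Z (P \<inter> Q))"
      using ne by (simp add: Z' PQ PiQ)
  qed
  show "translation_invariant Z"
    unfolding translation_invariant_def
  proof (intro ballI allI)
    fix P :: "(real ^ 'n) set" and x
    assume P: "P \<in> polytopes"
    have eq: "(\<lambda>y. y + x) ` P = (+) x ` P" by (simp add: add.commute)
    have "(\<lambda>y. y + x) ` P \<in> polytopes"
      using P unfolding eq by (simp add: polytopes_def polytope_translation_eq)
    then show "Z ((\<lambda>y. y + x) ` P) = Z P"
      by (simp only: Z' P) (simp add: eq Vn_def measure_translation)
  qed
  show "SL_invariant Z"
    unfolding SL_invariant_def
  proof (intro ballI allI impI)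
    fix P :: "(real ^ 'n) set" and \<phi> :: "real ^ 'n \<Rightarrow> real ^ 'n"
    assume P: "P \<in> polytopes" and \<phi>: "linear \<phi> \<and> det (matrix \<phi>) = 1"
    have "\<phi> ` P \<in> polytopes" using P \<phi> by (simp add: polytopes_def polytope_linear_image)
    moreover have "Vn (\<phi> ` P) = Vn P"
      unfolding Vn_def using P \<phi>
      by (subst measure_linear_image_finite)
        (auto simp: polytopes_def polytope_imp_compact lmeasurable_compact)
    ultimately show "Z (\<phi> ` P) = Z P" by (simp add: Z' P)
  qed
qed

lemma affine_invariant:
  fixes Z :: "(real ^ 'n) set \<Rightarrow> real"
  assumes "translation_invariant Z" "SL_invariant Z" "P \<in> polytopes" "linear \<phi>" "det (matrix \<phi>) = 1"
  shows "Z ((\<lambda>x. a + \<phi> x) ` P) = Z P"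
proof -
  have "\<phi> ` P \<in> polytopes" using assms by (simp add: polytopes_def polytope_linear_image)
  then have "Z ((\<lambda>y. y + a) ` (\<phi> ` P)) = Z P"
    using assms unfolding translation_invariant_def SL_invariant_def by metis
  then show ?thesis by (simp add: image_image add.commute)
qed

section \<open>Values on simplices\<close>

text \<open>
  Adds \<open>s\<close> times each of the other coordinates to the \<open>i\<close>-th one. It fixes the \<open>i\<close>-th axis vector and moves
  all others by the same vector along the \<open>i\<close>-th axis, so that after a translation only the two
  vertices on that axis have moved.
\<close>

definition shear :: "'n \<Rightarrow> real \<Rightarrow> real ^ 'n \<Rightarrow> real ^ 'n" where
  "shear i s x = x + (s * (\<Sum>j\<in>UNIV - {i}. x $ j)) *\<^sub>R axis i 1"

lemma linear_shear: "linear (shear i s)"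
  by (rule linearI) (simp_all add: shear_def sum.distrib algebra_simps flip: sum_distrib_left)

lemma shear_axis: "shear i s (axis j 1) = (if j = i then axis i 1 else axis j 1 + s *\<^sub>R axis i 1)"
proof -
  have "(\<Sum>k\<in>UNIV - {i}. axis j 1 $ k) = (\<Sum>k\<in>UNIV - {i}. if k = j then 1 else 0 :: real)"
    by (intro sum.cong) (auto simp: axis_def)
  then show ?thesis by (simp add: shear_def)
qed

lemma det_shear: "det (matrix (shear i s)) = 1"
proof -
  let ?I = "mat 1 :: real ^ 'a ^ 'a"
  define x where "x = (\<Sum>j\<in>UNIV - {i}. s *s row j ?I)"
  have x: "x $ l = (if l = i then 0 else s)" for l
    by (simp add: x_def row_def mat_def if_distrib cong: if_cong)
  have "matrix (shear i s) = (\<chi> k. if k = i then row i ?I + x else row k ?I)"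
    unfolding matrix_def shear_axis by (auto simp: vec_eq_iff x row_def mat_def axis_def)
  moreover have "x \<in> vec.span {row j ?I |j. j \<noteq> i}"
    unfolding x_def by (intro vec.span_sum vec.span_scale vec.span_base) auto
  ultimately show ?thesis using det_row_span[of x ?I i] by simp
qed

text \<open>
  The coordinate simplex over \<open>insert i J\<close> with its edge along the \<open>i\<close>-th axis scaled to length \<open>s\<close>.
  The degenerate case \<open>s = 0\<close> and negative \<open>s\<close> are allowed: the first is the common facet in the
  cut below, the second appears if the determinant of a linear map is negative.
\<close>

definition axis_simplex :: "'n \<Rightarrow> real \<Rightarrow> 'n set \<Rightarrow> (real ^ 'n) set" where
  "axis_simplex i s J = convex hull (insert 0 (insert (s *\<^sub>R axis i 1) ((\<lambda>j. axis j 1) ` J)))"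

definition std_simplex :: "'n set \<Rightarrow> (real ^ 'n) set" where
  "std_simplex J = convex hull (insert 0 ((\<lambda>j. axis j 1) ` J))"

lemma axis_simplex_0: "axis_simplex i 0 J = std_simplex J"
  by (simp add: axis_simplex_def std_simplex_def)

lemma axis_simplex_1: "axis_simplex i 1 J = std_simplex (insert i J)"
  by (simp add: axis_simplex_def std_simplex_def)

lemma axis_simplex_in_polytopes: "axis_simplex i s J \<in> polytopes"
  by (auto simp: axis_simplex_def polytopes_def intro!: polytope_convex_hull)

lemma std_simplex_in_polytopes: "std_simplex J \<in> polytopes"
  by (auto simp: std_simplex_def polytopes_def intro!: polytope_convex_hull)

lemma affine_image_convex_hull:
  assumes "linear f"
  shows "(\<lambda>x. a + f x) ` (convex hull S) = convex hull ((\<lambda>x. a + f x) ` S)"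
proof -
  have eq: "(\<lambda>x. a + f x) ` T = (+) a ` f ` T" for T by (simp add: image_image)
  show ?thesis
    unfolding eq convex_hull_translation convex_hull_linear_image[OF assms] ..
qed

text \<open>
  Slides the simplex along its \<open>i\<close>-th edge while all other vertices stay where they are.
\<close>

lemma shear_axis_simplex:
  assumes "i \<notin> J"
  shows "(\<lambda>x. s *\<^sub>R axis i 1 + shear i (- s) x) ` axis_simplex i t J
    = convex hull (insert (s *\<^sub>R axis i 1) (insert ((s + t) *\<^sub>R axis i 1) ((\<lambda>j. axis j 1) ` J)))"
proof -
  have "(\<lambda>x. s *\<^sub>R axis i 1 + shear i (- s) x) ` (\<lambda>j. axis j 1) ` J = (\<lambda>j. axis j 1) ` J"
    unfolding image_image using assms by (intro image_cong) (auto simp: shear_axis)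
  then show ?thesis
    unfolding axis_simplex_def
    by (simp add: affine_image_convex_hull linear_shear linear_0 linear_scale shear_axis
        scaleR_add_left)
qed

lemma convex_hull_split_edge:
  fixes a b c :: "'a::euclidean_space"
  assumes "c \<in> closed_segment a b"
  shows "convex hull (insert a (insert b E))
    = convex hull (insert a (insert c E)) \<union> convex hull (insert c (insert b E))"
proof (intro equalityI Un_least)
  have c: "c \<in> convex hull (insert a (insert b E))"
    using assms hull_mono[of "{a, b}" "insert a (insert b E)" convex]
    by (auto simp: segment_convex_hull)
  show "convex hull (insert a (insert c E)) \<subseteq> convex hull (insert a (insert b E))"
    "convex hull (insert c (insert b E)) \<subseteq> convex hull (insert a (insert b E))"
    by (rule hull_minimal; use c in \<open>auto intro: hull_inc\<close>)+
next
  show "convex hull (insert a (insert b E))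
    \<subseteq> convex hull (insert a (insert c E)) \<union> convex hull (insert c (insert b E))" (is "_ \<subseteq> ?A \<union> ?B")
  proof (cases "E = {}")
    case True
    then show ?thesis using Un_closed_segment[OF assms] by (simp add: segment_convex_hull)
  next
    case False
    have AB: "closed_segment a c \<subseteq> ?A" "closed_segment c b \<subseteq> ?B" "convex hull E \<subseteq> ?A" "convex hull E \<subseteq> ?B"
      unfolding segment_convex_hull by (auto intro!: hull_mono)
    have "convex hull (insert a (insert b E)) \<subseteq> convex hull (closed_segment a b \<union> convex hull E)"
      by (intro hull_minimal) (auto intro!: hull_inc)
    also have "\<dots> \<subseteq> ?A \<union> ?B"
    proof
      fix x assume "x \<in> convex hull (closed_segment a b \<union> convex hull E)"
      then obtain u v p q where x: "x = u *\<^sub>R p + v *\<^sub>R q" "u \<ge> 0" "v \<ge> 0" "u + v = 1"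
        "p \<in> closed_segment a b" "q \<in> convex hull E"
        using convex_hull_union_two[of "closed_segment a b" "convex hull E"] False by auto
      have "p \<in> closed_segment a c \<union> closed_segment c b"
        using x(5) Un_closed_segment[OF assms] by simp
      then show "x \<in> ?A \<union> ?B"
      proof
        assume "p \<in> closed_segment a c"
        then have "x \<in> ?A" unfolding x(1) using x AB by (intro convexD) auto
        then show ?thesis by simp
      next
        assume "p \<in> closed_segment c b"
        then have "x \<in> ?B" unfolding x(1) using x AB by (intro convexD) auto
        then show ?thesis by simp
      qed
    qed
    finally show ?thesis .
  qed
qed

lemma independent_axes:
  assumes "r \<noteq> 0" "i \<notin> J"
  shows "independent (insert (r *\<^sub>R axis i 1) ((\<lambda>j. axis j 1 :: real ^ 'n) ` J))"
  by (rule pairwise_orthogonal_independent)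
    (use assms in \<open>auto simp: pairwise_def orthogonal_def inner_axis_axis axis_eq_axis\<close>)

text \<open>
  Subdividing the edge of length \<open>s + t\<close> at distance \<open>s\<close> from the origin cuts the simplex into two, and
  the second part and the common facet are images of coordinate simplices under volume preserving
  affine maps.
\<close>

lemma axis_simplex_cut:
  assumes "s > 0" "t > 0" "i \<notin> J"
  defines "C \<equiv> (\<lambda>x. s *\<^sub>R axis i 1 + shear i (- s) x)"
  shows "axis_simplex i (s + t) J = axis_simplex i s J \<union> C ` axis_simplex i t J"
    "axis_simplex i s J \<inter> C ` axis_simplex i t J = C ` axis_simplex i 0 J"
proof -
  let ?E = "(\<lambda>j. axis j 1 :: real ^ 'a) ` J"
  let ?p = "s *\<^sub>R axis i 1 :: real ^ 'a" and ?q = "(s + t) *\<^sub>R axis i 1 :: real ^ 'a"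
  have p: "?p \<in> closed_segment 0 ?q"
    unfolding in_segment using assms by (intro exI[of _ "s / (s + t)"]) simp
  show "axis_simplex i (s + t) J = axis_simplex i s J \<union> C ` axis_simplex i t J"
    unfolding C_def shear_axis_simplex[OF assms(3)]
    unfolding axis_simplex_def by (rule convex_hull_split_edge[OF p])
  let ?S = "insert 0 (insert ?q ?E)"
  have ind: "independent (insert ?q ?E)" using assms by (intro independent_axes) auto
  then have nz: "0 \<notin> insert ?q ?E" by (metis dependent_zero)
  then have S: "\<not> affine_dependent ?S" using affine_dependent_iff_dependent[OF nz] ind by simp
  have "?p \<in> convex hull ?S"
    using p hull_mono[of "{0, ?q}" ?S convex] by (auto simp: segment_convex_hull)
  then have ex: "convex hull (insert ?p (insert 0 ?E)) \<inter> convex hull (insert ?p (insert ?q ?E))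
      = convex hull (insert ?p (insert 0 ?E \<inter> insert ?q ?E))"
    by (rule convex_hull_exchange_Int[OF S]) auto
  have "insert 0 ?E \<inter> insert ?q ?E = ?E" using nz by blast
  then show "axis_simplex i s J \<inter> C ` axis_simplex i t J = C ` axis_simplex i 0 J"
    unfolding C_def shear_axis_simplex[OF assms(3)]
    unfolding axis_simplex_def using ex by (simp add: insert_commute)
qed

locale SL_translation_valuation =
  fixes Z :: "(real ^ 'n) set \<Rightarrow> real"
  assumes val: "valuation Z" and trans: "translation_invariant Z" and SL: "SL_invariant Z"
begin

lemma Z_shear:
  "Z ((\<lambda>x. a + shear i s x) ` axis_simplex k t J) = Z (axis_simplex k t J)"
  by (rule affine_invariant[OF trans SL axis_simplex_in_polytopes linear_shear det_shear])

text \<open>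
  The Cauchy functional equation, up to the value at \<open>0\<close>, comes from \<open>axis_simplex_cut\<close>.
\<close>

lemma Z_axis_simplex_add:
  assumes "s \<ge> 0" "t \<ge> 0" "i \<notin> J"
  shows "Z (axis_simplex i (s + t) J) + Z (axis_simplex i 0 J)
    = Z (axis_simplex i s J) + Z (axis_simplex i t J)"
proof (cases "s = 0 \<or> t = 0")
  case False
  let ?C = "\<lambda>x. s *\<^sub>R axis i 1 + shear i (- s) x"
  have pos: "s > 0" "t > 0" using False assms by auto
  note cut = axis_simplex_cut[OF pos assms(3)]
  have poly: "?C ` axis_simplex i r J \<in> polytopes" for r
    unfolding shear_axis_simplex[OF assms(3)] polytopes_def
    by (auto intro!: polytope_convex_hull)
  let ?A = "axis_simplex i s J" and ?B = "?C ` axis_simplex i t J"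
  have "?A \<in> polytopes" "?B \<in> polytopes" "?A \<union> ?B \<in> polytopes"
    by (rule poly axis_simplex_in_polytopes | unfold cut(1)[symmetric])+
  then have "Z ?A + Z ?B = Z (?A \<union> ?B) + (if ?A \<inter> ?B = {} then 0 else Z (?A \<inter> ?B))"
    using val unfolding valuation_def by blast
  moreover have "?A \<inter> ?B \<noteq> {}"
    using poly[of 0] unfolding cut(2) by (simp add: polytopes_def)
  ultimately have "Z ?A + Z ?B = Z (axis_simplex i (s + t) J) + Z (?C ` axis_simplex i 0 J)"
    by (simp only: cut(1)[symmetric] cut(2) if_False simp_thms)
  then show ?thesis by (simp add: Z_shear)
qed auto

text \<open>
  Sliding by \<open>s\<close> moves the edge from \<open>- s\<close> to \<open>0\<close> onto the edge from \<open>0\<close> to \<open>s\<close>.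
\<close>

lemma Z_axis_simplex_uminus:
  assumes "i \<notin> J"
  shows "Z (axis_simplex i (- s) J) = Z (axis_simplex i s J)"
proof -
  have "(\<lambda>x. s *\<^sub>R axis i 1 + shear i (- s) x) ` axis_simplex i (- s) J = axis_simplex i s J"
    unfolding shear_axis_simplex[OF assms] by (simp add: axis_simplex_def insert_commute)
  then show ?thesis using Z_shear by metis
qed

lemma Z_axis_simplex_abs: "i \<notin> J \<Longrightarrow> Z (axis_simplex i \<bar>s\<bar> J) = Z (axis_simplex i s J)"
  by (cases "s \<ge> 0") (auto simp: Z_axis_simplex_uminus)

text \<open>
  In lower dimension there is a spare coordinate \<open>k\<close>. Stretching the edge by \<open>2\<close> can then be compensated
  by shrinking along \<open>k\<close>, so the lengths \<open>1\<close> and \<open>2\<close> have the same value, and the functional equation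
  gives this value at length \<open>0\<close>, too.
\<close>

lemma Z_std_simplex_insert:
  assumes "insert i J \<noteq> UNIV" "i \<notin> J"
  shows "Z (std_simplex (insert i J)) = Z (std_simplex J)"
proof -
  obtain k where k: "k \<noteq> i" "k \<notin> J" using assms(1) by blast
  define c where "c j = (if j = i then 2 else if j = k then 1 / 2 else 1 :: real)" for j
  have "(\<Prod>j\<in>UNIV. c j) = (\<Prod>j\<in>{i, k}. c j)"
    by (rule prod.mono_neutral_right) (auto simp: c_def)
  then have det: "det (matrix (stretch c)) = 1" using k by (simp add: det_stretch c_def)
  have "stretch c ` (\<lambda>j. axis j 1) ` J = (\<lambda>j. axis j 1) ` J"
    unfolding image_image using assms k by (intro image_cong) (auto simp: stretch_axis c_def)
  then have "(\<lambda>x. 0 + stretch c x) ` axis_simplex i 1 J = axis_simplex i 2 J"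
    by (simp add: axis_simplex_def convex_hull_linear_image linear_stretch linear_0 stretch_axis c_def)
  then have "Z (axis_simplex i 2 J) = Z (axis_simplex i 1 J)"
    using affine_invariant[OF trans SL axis_simplex_in_polytopes linear_stretch det] by metis
  then show ?thesis
    using Z_axis_simplex_add[of 1 1 i J] assms(2) by (simp add: axis_simplex_0 axis_simplex_1)
qed

lemma Z_std_simplex_lower_dim:
  assumes "J \<noteq> UNIV"
  shows "Z (std_simplex J) = Z {0}"
  using finite[of J] assms
proof (induction J rule: finite_induct)
  case empty
  then show ?case by (simp add: std_simplex_def)
next
  case (insert i J)
  then show ?case using Z_std_simplex_insert[of i J] by auto
qed

end

text \<open>
  The edge vectors at a vertex are independent. They extend to a basis, which is the image of the
  standard basis under a linear map.
\<close>

lemma simplex_affine_image_std_simplex: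
  fixes S :: "(real ^ 'n) set"
  assumes "n simplex S" "S \<noteq> {}"
  obtains J :: "'n set" and A a
  where "linear A" "det (matrix A) \<noteq> 0" "S = (\<lambda>x. a + A x) ` std_simplex J"
proof -
  obtain C where C: "\<not> affine_dependent C" "S = convex hull C"
    using assms(1) by (auto simp: simplex_def)
  then obtain a where a: "a \<in> C" using assms(2) by fastforce
  define B where "B = (\<lambda>x. - a + x) ` (C - {a})"
  have "independent B"
    using affine_dependent_iff_dependent[of a "C - {a}"] C(1) a by (simp add: B_def insert_absorb)
  then obtain B' where B': "B \<subseteq> B'" "independent B'" "UNIV \<subseteq> span B'"
    using maximal_independent_subset_extend[of B UNIV] by auto
  have "card B' = CARD('n)" using basis_card_eq_dim[of B' UNIV] B' by simp
  then obtain h :: "'n \<Rightarrow> real ^ 'n" where h: "bij_betw h UNIV B'"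
    using finite_same_card_bij[of "UNIV :: 'n set" B'] finiteI_independent[OF B'(2)] by auto
  define A where "A x = (\<Sum>i\<in>UNIV. x $ i *\<^sub>R h i)" for x :: "real ^ 'n"
  have A: "linear A"
    by (rule linearI) (simp_all add: A_def scaleR_add_left sum.distrib scaleR_sum_right)
  have A_axis: "A (axis i 1) = h i" for i
    by (simp add: A_def axis_def if_distrib if_distribR cong: if_cong)
  have "range h \<subseteq> range A" using A_axis by (metis image_subsetI rangeI)
  then have "B' \<subseteq> range A" using h by (simp add: bij_betw_def)
  then have "surj A"
    using span_minimal[OF _ linear_subspace_image[OF A subspace_UNIV]] B'(3) by blast
  then have "det (matrix A) \<noteq> 0"
    using det_nz_iff_inj[OF A] linear_surjective_imp_injective[OF A] by blast
  define J where "J = h -` B"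
  have "h ` J = B" using h B'(1) by (auto simp: J_def bij_betw_def)
  have "(\<lambda>x. a + A x) ` insert 0 ((\<lambda>j. axis j 1) ` J) = insert a ((+) a ` h ` J)"
    by (simp add: image_image A_axis linear_0[OF A])
  also have "\<dots> = C" unfolding \<open>h ` J = B\<close> B_def using a by (auto simp: image_image)
  finally have "S = (\<lambda>x. a + A x) ` std_simplex J"
    by (simp add: C(2) std_simplex_def affine_image_convex_hull[OF A])
  then show ?thesis using that A \<open>det (matrix A) \<noteq> 0\<close> by blast
qed

lemma affine_image_comp:
  assumes "A = A' \<circ> D" "D ` T = T'"
  shows "(\<lambda>x. a + A x) ` T = (\<lambda>x. a + A' x) ` T'"
  unfolding assms(1) assms(2)[symmetric] image_image o_def ..

text \<open>
  Concentrates the determinant of a linear map in one freely chosen coordinate direction.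
\<close>

lemma factor_stretch:
  fixes A :: "real ^ 'n \<Rightarrow> real ^ 'n"
  assumes "linear A" "det (matrix A) \<noteq> 0"
  obtains A' where "linear A'" "det (matrix A') = 1"
    "A = A' \<circ> stretch (\<lambda>j. if j = i then det (matrix A) else 1)"
proof
  let ?d = "det (matrix A)"
  let ?A' = "A \<circ> stretch (\<lambda>j. if j = i then 1 / ?d else 1)"
  show "linear ?A'" using assms(1) linear_stretch by (rule linear_compose[rotated])
  have "matrix ?A' = matrix A ** matrix (stretch (\<lambda>j. if j = i then 1 / ?d else 1))"
    using linear_stretch assms(1) by (rule matrix_compose)
  then show "det (matrix ?A') = 1" using assms(2) by (simp add: det_mul det_stretch)
  have "stretch (\<lambda>j. if j = i then 1 / ?d else 1) (stretch (\<lambda>j. if j = i then ?d else 1) x) = x" for x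
    using assms(2) by (simp add: stretch_def vec_eq_iff)
  then show "A = ?A' \<circ> stretch (\<lambda>j. if j = i then ?d else 1)"
    by (simp add: fun_eq_iff)
qed

lemma Vn_affine_image:
  assumes "linear A" "P \<in> polytopes"
  shows "Vn ((\<lambda>x. a + A x) ` P) = \<bar>det (matrix A)\<bar> * Vn P"
proof -
  have "Vn ((\<lambda>x. a + A x) ` P) = measure lebesgue ((+) a ` A ` P)"
    by (simp add: Vn_def image_image)
  then show ?thesis
    using assms by (simp add: measure_translation measure_linear_image_finite Vn_def polytopes_def
        polytope_imp_compact lmeasurable_compact)
qed

lemma Vn_std_simplex_lower_dim:
  assumes "J \<noteq> UNIV"
  shows "Vn (std_simplex J :: (real ^ 'n) set) = 0"
proof -
  obtain k where k: "k \<notin> J" using assms by blast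
  have "std_simplex J \<subseteq> {x :: real ^ 'n. x $ k = 0}"
    unfolding std_simplex_def
  proof (rule hull_minimal)
    show "convex {x :: real ^ 'n. x $ k = 0}" by (auto simp: convex_def)
  qed (use k in \<open>auto simp: axis_def\<close>)
  then have "negligible (std_simplex J :: (real ^ 'n) set)"
    using negligible_subset[OF negligible_standard_hyperplane_cart] by blast
  then show ?thesis unfolding Vn_def by (rule negligible_imp_measure0)
qed

lemma Vn_std_simplex_UNIV: "Vn (std_simplex UNIV :: (real ^ 'n) set) > 0"
proof -
  have "std_simplex UNIV = (convex hull (insert 0 Basis) :: (real ^ 'n) set)"
    by (rule arg_cong[of _ _ "\<lambda>S. convex hull (insert 0 S)", THEN trans[OF std_simplex_def]])
      (auto simp: Basis_vec_def)
  moreover have "(convex hull (insert 0 Basis) :: (real ^ 'n) set) \<in> sets borel"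
    by (intro borel_compact compact_convex_hull finite_imp_compact) simp
  ultimately show ?thesis
    using content_std_simplex[where 'a = "real ^ 'n"] by (simp add: Vn_def measure_completion)
qed

context SL_translation_valuation
begin

text \<open>
  Every simplex is, up to an affine map of determinant \<open>1\<close>, a coordinate simplex stretched in a single
  direction. If it is not full-dimensional, that direction can be chosen outside its span, where
  the stretching has no effect; otherwise the volume is proportional to the length of the
  stretched edge. The quotient on the right covers both cases, since in the first it is \<open>0\<close>.
\<close>

lemma Z_simplex:
  assumes "n simplex S" "S \<noteq> {}"
  shows "Z S = Z (axis_simplex i (Vn S / Vn (std_simplex UNIV :: (real ^ 'n) set)) (- {i}))"
proof -
  obtain J A a where A: "linear A" "det (matrix A) \<noteq> 0" and S: "S = (\<lambda>x. a + A x) ` std_simplex J"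
    using simplex_affine_image_std_simplex[OF assms] .
  let ?d = "det (matrix A)"
  have Vn: "Vn S = \<bar>?d\<bar> * Vn (std_simplex J)"
    unfolding S by (rule Vn_affine_image[OF A(1) std_simplex_in_polytopes])
  show ?thesis
  proof (cases "J = UNIV")
    case False
    then obtain k where k: "k \<notin> J" by blast
    obtain A' where A': "linear A'" "det (matrix A') = 1"
      and A_eq: "A = A' \<circ> stretch (\<lambda>j. if j = k then ?d else 1)"
      using factor_stretch[OF A] .
    have "stretch (\<lambda>j. if j = k then ?d else 1) ` (\<lambda>j. axis j 1) ` J = (\<lambda>j. axis j 1) ` J"
      unfolding image_image using k by (intro image_cong) (auto simp: stretch_axis)
    then have "stretch (\<lambda>j. if j = k then ?d else 1) ` std_simplex J = std_simplex J"
      by (simp add: std_simplex_def convex_hull_linear_image linear_stretch linear_0)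
    then have "S = (\<lambda>x. a + A' x) ` std_simplex J"
      unfolding S by (rule affine_image_comp[OF A_eq])
    then have "Z S = Z (std_simplex J)"
      using affine_invariant[OF trans SL std_simplex_in_polytopes A'] by simp
    moreover have "- {i} \<noteq> UNIV" by blast
    ultimately show ?thesis
      using False by (simp add: Vn Z_std_simplex_lower_dim Vn_std_simplex_lower_dim axis_simplex_0)
  next
    case True
    obtain A' where A': "linear A'" "det (matrix A') = 1"
      and A_eq: "A = A' \<circ> stretch (\<lambda>j. if j = i then ?d else 1)"
      using factor_stretch[OF A] .
    have "stretch (\<lambda>j. if j = i then ?d else 1) ` (\<lambda>j. axis j 1) ` (- {i}) = (\<lambda>j. axis j 1) ` (- {i})"
      unfolding image_image by (intro image_cong) (auto simp: stretch_axis)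
    then have "stretch (\<lambda>j. if j = i then ?d else 1) ` axis_simplex i 1 (- {i})
        = axis_simplex i ?d (- {i})"
      by (simp add: axis_simplex_def convex_hull_linear_image linear_stretch linear_0 stretch_axis)
    moreover have "insert i (- {i}) = UNIV" by blast
    ultimately have "stretch (\<lambda>j. if j = i then ?d else 1) ` std_simplex UNIV
        = axis_simplex i ?d (- {i})"
      by (simp add: axis_simplex_1)
    then have "S = (\<lambda>x. a + A' x) ` axis_simplex i ?d (- {i})"
      unfolding S True by (rule affine_image_comp[OF A_eq])
    then have "Z S = Z (axis_simplex i ?d (- {i}))"
      using affine_invariant[OF trans SL axis_simplex_in_polytopes A'] by simp
    then have "Z S = Z (axis_simplex i \<bar>?d\<bar> (- {i}))" by (simp add: Z_axis_simplex_abs)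
    then show ?thesis using Vn_std_simplex_UNIV[where 'n = 'n] by (simp add: Vn True)
  qed
qed

end

section \<open>Classification\<close>

lemma valuation_diff:
  fixes Z Z' :: "(real ^ 'n) set \<Rightarrow> real"
  assumes "valuation Z" "valuation Z'"
  shows "valuation (\<lambda>P. Z P - Z' P)"
  unfolding valuation_def
proof (intro ballI impI)
  fix P Q :: "(real ^ 'n) set"
  assume PQ: "P \<in> polytopes" "Q \<in> polytopes" "P \<union> Q \<in> polytopes"
  have "Z P + Z Q = Z (P \<union> Q) + (if P \<inter> Q = {} then 0 else Z (P \<inter> Q))"
    "Z' P + Z' Q = Z' (P \<union> Q) + (if P \<inter> Q = {} then 0 else Z' (P \<inter> Q))"
    using assms PQ unfolding valuation_def by blast+
  then show "Z P - Z' P + (Z Q - Z' Q) = Z (P \<union> Q) - Z' (P \<union> Q)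
      + (if P \<inter> Q = {} then 0 else Z (P \<inter> Q) - Z' (P \<inter> Q))"
    by (auto split: if_splits)
qed

theorem theorem3p4:
  fixes Z :: "(real ^ 'n) set \<Rightarrow> real"
  shows "valuation Z \<and> translation_invariant Z \<and> SL_invariant Z \<longleftrightarrow>
    (\<exists>c0 \<zeta>. cauchy_function \<zeta> \<and> (\<forall>P\<in>polytopes. Z P = c0 * V0 P + \<zeta> (Vn P)))"
proof
  assume "\<exists>c0 \<zeta>. cauchy_function \<zeta> \<and> (\<forall>P\<in>polytopes. Z P = c0 * V0 P + \<zeta> (Vn P))"
  then obtain c0 \<zeta> where "cauchy_function \<zeta>" "\<And>P. P \<in> polytopes \<Longrightarrow> Z P = c0 * V0 P + \<zeta> (Vn P)"
    by blast
  then show "valuation Z \<and> translation_invariant Z \<and> SL_invariant Z"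
    using valuation_representation[of \<zeta> Z c0] by blast
next
  assume "valuation Z \<and> translation_invariant Z \<and> SL_invariant Z"
  then interpret SL_translation_valuation Z by unfold_locales auto
  \<comment> \<open>The simplex with stretched edge \<open>s\<close> has volume \<open>s * v\<close>, so \<open>f (x / v)\<close> is the value at volume \<open>x\<close>.\<close>
  fix i :: 'n
  define f where "f s = Z (axis_simplex i s (- {i}))" for s
  define v where "v = Vn (std_simplex UNIV :: (real ^ 'n) set)"
  define \<zeta> where "\<zeta> x = f (x / v) - f 0" for x
  define R where "R P = f 0 * V0 P + \<zeta> (Vn P)" for P :: "(real ^ 'n) set"
  have v: "v > 0" unfolding v_def by (rule Vn_std_simplex_UNIV)
  have "cauchy_function \<zeta>"
    unfolding cauchy_function_def
  proof (intro allI impI)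
    fix x y :: real
    assume "x \<ge> 0" "y \<ge> 0"
    then have "f (x / v + y / v) + f 0 = f (x / v) + f (y / v)"
      unfolding f_def using v by (intro Z_axis_simplex_add) auto
    then show "\<zeta> (x + y) = \<zeta> x + \<zeta> y" by (simp add: \<zeta>_def add_divide_distrib)
  qed
  \<comment> \<open>Both \<open>Z\<close> and \<open>R\<close> are valuations, and they agree on simplices.\<close>
  have "Z P - R P = 0" if "P \<in> polytopes" for P
  proof (rule valuation_vanishes_on_polytopes[where Z = "\<lambda>P. Z P - R P", OF _ _ that])
    have "valuation R" by (rule valuation_representation(1)[OF \<open>cauchy_function \<zeta>\<close> R_def])
    then show "valuation (\<lambda>P. Z P - R P)" by (rule valuation_diff[OF val])
    show "Z S - R S = 0" if S: "n simplex S" "S \<noteq> {}" for n S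
    proof -
      have "S \<in> polytopes" using S by (simp add: polytopes_def simplex_imp_polytope)
      then show ?thesis
        using Z_simplex[OF S, of i] by (simp add: R_def V0_eq_1 \<zeta>_def f_def v_def)
    qed
  qed
  then show "\<exists>c0 \<zeta>. cauchy_function \<zeta> \<and> (\<forall>P\<in>polytopes. Z P = c0 * V0 P + \<zeta> (Vn P))"
    using \<open>cauchy_function \<zeta>\<close> unfolding R_def by (metis eq_iff_diff_eq_0)
qed

end
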